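(* Let $X,Y$ be Banach spaces, $D\subset X$ a nonempty open convex set, and $F:D\to Y$ a twice continuously (Fréchet) differentiable operator. Assume that there is $x_0\in D$ such that $F'(x_0)^{-1}$ exists and that, for some $R>0$, $h:[0,R)\to\mathbb{R}$ is a majorizing function to $F$ at $x_0$. Let $t^*$ be the smallest zero of $h$ in $(0,R)$. Then the sequence $\{x_k\}$ generated by Halley's method with starting point $x_0$, $$x_{k+1}=x_k-[I-L_F(x_k)]^{-1}F'(x_k)^{-1}F(x_k),\quad k=0,1,2,\ldots,$$ is well defined, is contained in $B(x_0,t^* )$, and converges to a point $x^*\in\overline{B(x_0,t^* )}$ which is a solution of $F(x)=0$.
   Context: $B(x,r)$ is the open ball with center $x$ and radius $r$, and $\overline{B(x,r)}$ its closure. $I$ is the identity operator. $L_F(x)=\frac12F'(x)^{-1}F''(x)F'(x)^{-1}F(x)$, i.e. the bounded linear operator $v\mapsto\frac12F'(x)^{-1}F''(x)\big(F'(x)^{-1}F(x),v\big)$ on $X$. Majorizing function: let $R>0$ and $F'(x_0)$ be nonsingular (boundedly invertible). A twice continuously differentiable $h:[0,R)\to\mathbb{R}$ is a majorizing function to $F$ at $x_0$ if $B(x_0,R)\subset D$ and all of the following hold: (1) $\|F'(x_0)^{-1}[F''(y)-F''(x)]\|\le h''(\|y-x\|+\|x-x_0\|)-h''(\|x-x_0\|)$ for all $x,y\in B(x_0,R)$ with $\|y-x\|+\|x-x_0\|<R$; (2) $\|F'(x_0)^{-1}F(x_0)\|\le h(0)$ and $\|F'(x_0)^{-1}F''(x_0)\|\le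 h''(0)$; (3) $h(0)>0$, $h''(0)>0$, $h'(0)=-1$; (4) $h''$ is convex and strictly increasing on $[0,R)$; (5) $h$ has a zero in $(0,R)$ and, denoting by $t^*$ its smallest zero, $h'(t^* )<0$. *)

theory Defs
  imports "HOL-Analysis.Analysis"
begin

definition boundedly_invertible ::
  "('a::real_normed_vector \<Rightarrow>\<^sub>L 'b::real_normed_vector) \<Rightarrow> bool" where
  "boundedly_invertible A \<longleftrightarrow> (\<exists>G. G o\<^sub>L A = id_blinfun \<and> A o\<^sub>L G = id_blinfun)"

text \<open>The value of \<open>blinfun_inv A\<close> is meaningful only if \<open>A\<close> is boundedly invertible.\<close>

definition blinfun_inv ::
  "('a::real_normed_vector \<Rightarrow>\<^sub>L 'b::real_normed_vector) \<Rightarrow> ('b \<Rightarrow>\<^sub>L 'a)" where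
  "blinfun_inv A = (THE G. G o\<^sub>L A = id_blinfun \<and> A o\<^sub>L G = id_blinfun)"

lemma blinfun_inv_eqI:
  assumes "G o\<^sub>L A = id_blinfun" and "A o\<^sub>L G = id_blinfun"
  shows "blinfun_inv A = G"
  unfolding blinfun_inv_def
proof (rule the_equality)
  fix H assume H: "H o\<^sub>L A = id_blinfun \<and> A o\<^sub>L H = id_blinfun"
  show "H = G"
  proof (rule blinfun_eqI)
    fix y
    have "blinfun_apply A (blinfun_apply G y) = y"
      using assms(2) by (metis blinfun_apply_blinfun_compose blinfun_apply_id_blinfun)
    moreover have "blinfun_apply H (blinfun_apply A (blinfun_apply G y)) = blinfun_apply G y"
      using H by (metis blinfun_apply_blinfun_compose blinfun_apply_id_blinfun)
    ultimately show "blinfun_apply H y = blinfun_apply G y" by simp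
  qed
qed (use assms in simp)

lemma blinfun_inv_inverse:
  assumes "boundedly_invertible A"
  shows "blinfun_inv A o\<^sub>L A = id_blinfun" and "A o\<^sub>L blinfun_inv A = id_blinfun"
  using assms unfolding boundedly_invertible_def by (metis blinfun_inv_eqI)+

text \<open>
  Bilinear maps are elements of \<open>'a \<Rightarrow>\<^sub>L 'a \<Rightarrow>\<^sub>L 'b\<close>, whose norm is the usual norm of a bounded
  bilinear map; \<open>bilin_compose G B\<close> is the bilinear map \<open>(u, v) \<mapsto> G (B (u, v))\<close>.
\<close>

definition bilin_compose ::
  "('b::real_normed_vector \<Rightarrow>\<^sub>L 'c::real_normed_vector) \<Rightarrow>
   ('a::real_normed_vector \<Rightarrow>\<^sub>L 'a \<Rightarrow>\<^sub>L 'b) \<Rightarrow> ('a \<Rightarrow>\<^sub>L 'a \<Rightarrow>\<^sub>L 'c)" where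
  "bilin_compose G B = Blinfun (\<lambda>A. G o\<^sub>L A) o\<^sub>L B"

lemma bilin_compose_apply:
  fixes G :: "'b::real_normed_vector \<Rightarrow>\<^sub>L 'c::real_normed_vector"
    and B :: "'a::real_normed_vector \<Rightarrow>\<^sub>L 'a \<Rightarrow>\<^sub>L 'b"
  shows "blinfun_apply (blinfun_apply (bilin_compose G B) u) v =
   blinfun_apply G (blinfun_apply (blinfun_apply B u) v)"
proof -
  have "bounded_linear (\<lambda>A :: 'a \<Rightarrow>\<^sub>L 'b. G o\<^sub>L A)"
    by (rule bounded_bilinear.bounded_linear_right[OF bounded_bilinear_blinfun_compose])
  then show ?thesis
    by (simp add: bilin_compose_def bounded_linear_Blinfun_apply)
qed

definition twice_cont_frechet_diff_on ::
  "'a set \<Rightarrow> ('a::real_normed_vector \<Rightarrow> 'b::real_normed_vector) \<Rightarrow>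
   ('a \<Rightarrow> 'a \<Rightarrow>\<^sub>L 'b) \<Rightarrow> ('a \<Rightarrow> 'a \<Rightarrow>\<^sub>L 'a \<Rightarrow>\<^sub>L 'b) \<Rightarrow> bool" where
  "twice_cont_frechet_diff_on D F F' F'' \<longleftrightarrow>
     (\<forall>x\<in>D. (F has_derivative blinfun_apply (F' x)) (at x)) \<and>
     (\<forall>x\<in>D. (F' has_derivative blinfun_apply (F'' x)) (at x)) \<and>
     continuous_on D F''"

definition is_smallest_zero :: "(real \<Rightarrow> real) \<Rightarrow> real \<Rightarrow> real \<Rightarrow> bool" where
  "is_smallest_zero h R t \<longleftrightarrow>
     t \<in> {0<..<R} \<and> h t = 0 \<and> (\<forall>s\<in>{0<..<R}. h s = 0 \<longrightarrow> t \<le> s)"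

text \<open>Only the values of \<open>h\<close>, \<open>h'\<close>, \<open>h''\<close> on \<open>[0, R)\<close> matter; derivatives at \<open>0\<close> are one-sided.\<close>

definition majorizing_function ::
  "'a set \<Rightarrow> ('a::real_normed_vector \<Rightarrow> 'b::real_normed_vector) \<Rightarrow>
   ('a \<Rightarrow> 'a \<Rightarrow>\<^sub>L 'b) \<Rightarrow> ('a \<Rightarrow> 'a \<Rightarrow>\<^sub>L 'a \<Rightarrow>\<^sub>L 'b) \<Rightarrow> 'a \<Rightarrow> real \<Rightarrow>
   (real \<Rightarrow> real) \<Rightarrow> (real \<Rightarrow> real) \<Rightarrow> (real \<Rightarrow> real) \<Rightarrow> bool" where
  "majorizing_function D F F' F'' x0 R h h' h'' \<longleftrightarrow>
     (\<forall>t\<in>{0..<R}. (h has_real_derivative h' t) (at t within {0..<R})) \<and>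
     (\<forall>t\<in>{0..<R}. (h' has_real_derivative h'' t) (at t within {0..<R})) \<and>
     continuous_on {0..<R} h'' \<and>
     ball x0 R \<subseteq> D \<and>
     (\<forall>x\<in>ball x0 R. \<forall>y\<in>ball x0 R. norm (y - x) + norm (x - x0) < R \<longrightarrow>
        norm (bilin_compose (blinfun_inv (F' x0)) (F'' y - F'' x))
          \<le> h'' (norm (y - x) + norm (x - x0)) - h'' (norm (x - x0))) \<and>
     norm (blinfun_apply (blinfun_inv (F' x0)) (F x0)) \<le> h 0 \<and>
     norm (bilin_compose (blinfun_inv (F' x0)) (F'' x0)) \<le> h'' 0 \<and>
     h 0 > 0 \<and> h'' 0 > 0 \<and> h' 0 = -1 \<and>
     convex_on {0..<R} h'' \<and> strict_mono_on {0..<R} h'' \<and>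
     (\<exists>t. is_smallest_zero h R t \<and> h' t < 0)"

definition halley_L ::
  "('a::real_normed_vector \<Rightarrow> 'b::real_normed_vector) \<Rightarrow>
   ('a \<Rightarrow> 'a \<Rightarrow>\<^sub>L 'b) \<Rightarrow> ('a \<Rightarrow> 'a \<Rightarrow>\<^sub>L 'a \<Rightarrow>\<^sub>L 'b) \<Rightarrow> 'a \<Rightarrow> ('a \<Rightarrow>\<^sub>L 'a)" where
  "halley_L F F' F'' x =
     (1 / 2) *\<^sub>R (blinfun_inv (F' x) o\<^sub>L
       blinfun_apply (F'' x) (blinfun_apply (blinfun_inv (F' x)) (F x)))"

definition halley_step_defined ::
  "'a set \<Rightarrow> ('a::real_normed_vector \<Rightarrow> 'b::real_normed_vector) \<Rightarrow>
   ('a \<Rightarrow> 'a \<Rightarrow>\<^sub>L 'b) \<Rightarrow> ('a \<Rightarrow> 'a \<Rightarrow>\<^sub>L 'a \<Rightarrow>\<^sub>L 'b) \<Rightarrow> 'a \<Rightarrow> bool" where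
  "halley_step_defined D F F' F'' x \<longleftrightarrow>
     x \<in> D \<and> boundedly_invertible (F' x) \<and>
     boundedly_invertible (id_blinfun - halley_L F F' F'' x)"

text \<open>
  The sequence is total in HOL; it is the genuine Halley sequence as long as
  \<open>halley_step_defined\<close> holds at every iterate.
\<close>

primrec halley_seq ::
  "('a::real_normed_vector \<Rightarrow> 'b::real_normed_vector) \<Rightarrow>
   ('a \<Rightarrow> 'a \<Rightarrow>\<^sub>L 'b) \<Rightarrow> ('a \<Rightarrow> 'a \<Rightarrow>\<^sub>L 'a \<Rightarrow>\<^sub>L 'b) \<Rightarrow> 'a \<Rightarrow> nat \<Rightarrow> 'a" where
  "halley_seq F F' F'' x0 0 = x0"
| "halley_seq F F' F'' x0 (Suc k) =
     (let x = halley_seq F F' F'' x0 k in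
      x - blinfun_apply (blinfun_inv (id_blinfun - halley_L F F' F'' x))
            (blinfun_apply (blinfun_inv (F' x)) (F x)))"

end

theory Submission
  imports Defs
begin

text \<open>
  Run the scalar Halley iteration \<open>t \<mapsto> t + s\<close> for \<open>h\<close> from \<open>0\<close> alongside the operator iteration,
  with \<open>\<Gamma> = F'(x0)\<^sup>-\<^sup>1\<close>. The conditions \<open>\<parallel>x - x0\<parallel> \<le> t\<close> and \<open>\<parallel>\<Gamma> F x\<parallel> \<le> h t\<close> with \<open>t < t*\<close> are preserved by a
  simultaneous step, and the step of \<open>x\<close> has length at most \<open>s\<close>: with Newton step \<open>u\<close>, the Halley
  step \<open>d\<close> satisfies \<open>F x + F' d + F''(u, d) / 2 = 0\<close>, so \<open>F (x + d)\<close> is a Taylor remainder plus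
  \<open>F''(d - u, d) / 2\<close>, and the scalar step satisfies the same identity with all bounds attained.
  Since \<open>-1 \<le> h' < 0\<close>, \<open>h t \<le> s\<close>; the scalar steps are summable, so \<open>x\<close> converges and \<open>F x \<rightarrow> 0\<close>.
\<close>

section \<open>Inversion of perturbations of the identity\<close>

lemma
  fixes A :: "'a::banach \<Rightarrow>\<^sub>L 'a"
  assumes "norm A < 1"
  shows boundedly_invertible_id_minus: "boundedly_invertible (id_blinfun - A)"
    and norm_inv_id_minus_le: "norm (blinfun_inv (id_blinfun - A)) \<le> 1 / (1 - norm A)"
proof -
  \<comment> \<open>The equation \<open>(id_blinfun - A) x = y\<close> says that \<open>x\<close> is
    a fixed point of the contraction \<open>\<lambda>x. y + A x\<close>. So \<open>g\<close> is the
    candidate inverse, and uniqueness of the fixed point yields its linearity.\<close>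
  have ex1: "\<exists>!x. y + A x = x" for y
  proof (rule banach_fix_type)
    show "\<forall>u v. dist (y + A u) (y + A v) \<le> norm A * dist u v"
      by (metis blinfun.diff_right dist_add_cancel dist_norm norm_blinfun)
  qed (use assms in auto)
  define g where "g y = (THE x. y + A x = x)" for y
  have g: "y + A (g y) = g y" for y
    unfolding g_def by (rule theI'[OF ex1])
  have g_eq: "g y = x" if "y + A x = x" for x y
    using ex1[of y] g[of y] that by blast
  have bound: "norm (g y) \<le> norm y * (1 / (1 - norm A))" for y
  proof -
    have "norm (g y) \<le> norm y + norm A * norm (g y)"
      by (metis g norm_blinfun norm_triangle_mono order_refl)
    then have "norm (g y) * (1 - norm A) \<le> norm y" by (simp add: algebra_simps)
    then show ?thesis using assms by (simp add: field_simps)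
  qed
  have lin: "bounded_linear g"
  proof (rule bounded_linear_intro[OF _ _ bound])
    show "g (x + y) = g x + g y" for x y
    proof (rule g_eq)
      have "x + y + A (g x + g y) = (x + A (g x)) + (y + A (g y))"
        by (simp add: blinfun.add_right algebra_simps)
      then show "x + y + A (g x + g y) = g x + g y" by (simp only: g)
    qed
    show "g (r *\<^sub>R x) = r *\<^sub>R g x" for r x
    proof (rule g_eq)
      have "r *\<^sub>R x + A (r *\<^sub>R g x) = r *\<^sub>R (x + A (g x))"
        by (simp add: blinfun.scaleR_right algebra_simps)
      then show "r *\<^sub>R x + A (r *\<^sub>R g x) = r *\<^sub>R g x" by (simp only: g)
    qed
  qed
  have G: "Blinfun g x = g x" for x
    by (simp add: lin bounded_linear_Blinfun_apply)
  have 1: "Blinfun g o\<^sub>L (id_blinfun - A) = id_blinfun"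
    by (rule blinfun_eqI) (auto simp: G blinfun.diff_left intro!: g_eq)
  have 2: "(id_blinfun - A) o\<^sub>L Blinfun g = id_blinfun"
    by (rule blinfun_eqI) (metis G add_diff_cancel_right' blinfun.diff_left
        blinfun_apply_blinfun_compose blinfun_apply_id_blinfun g)
  show "boundedly_invertible (id_blinfun - A)"
    using 1 2 unfolding boundedly_invertible_def by blast
  have "norm (Blinfun g) \<le> 1 / (1 - norm A)"
    using bound assms by (intro norm_blinfun_bound) (auto simp: G field_simps)
  then show "norm (blinfun_inv (id_blinfun - A)) \<le> 1 / (1 - norm A)"
    using blinfun_inv_eqI[OF 1 2] by simp
qed

lemma norm_bilin_apply_le:
  fixes B :: "'a::real_normed_vector \<Rightarrow>\<^sub>L 'a \<Rightarrow>\<^sub>L 'b::real_normed_vector"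
  shows "norm (B u v) \<le> norm B * norm u * norm v"
  by (meson dual_order.trans mult_right_mono norm_blinfun norm_ge_zero)

text \<open>The points \<open>r + b\<close> and \<open>t\<close> are convex combinations of
  \<open>r\<close> and \<open>t + b\<close> with swapped weights, so adding the two convexity
  inequalities cancels the weights. This lets the bound on the variation of \<open>F''\<close>,
  based at radius \<open>norm (x - x0)\<close>, be moved to any larger \<open>t\<close>.\<close>

lemma convex_on_diff_mono:
  fixes f :: "real \<Rightarrow> real"
  assumes "convex_on S f" "r \<in> S" "t + b \<in> S" "r \<le> t" "0 \<le> b"
  shows "f (r + b) - f r \<le> f (t + b) - f t"
\<comment> \<open>Equality forces \<open>b = 0\<close> and \<open>r = t\<close>, where the weight
  \<open>l\<close> would divide by zero.\<close>
proof (cases "r = t + b")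
  case False
  define l where "l = b / (t + b - r)"
  have pos: "t + b - r > 0" using False assms(4,5) by linarith
  have l: "0 \<le> l" "l \<le> 1" using pos assms(4,5) by (auto simp: l_def field_simps)
  have "l * (t + b - r) = b" using pos by (simp add: l_def)
  then have eq: "(1 - l) * r + l * (t + b) = r + b" "l * r + (1 - l) * (t + b) = t"
    by (simp_all add: algebra_simps)
  have "f (r + b) \<le> (1 - l) * f r + l * f (t + b)"
    using convex_onD[OF assms(1) l assms(2,3)] eq by simp
  moreover have "f t \<le> l * f r + (1 - l) * f (t + b)"
    using convex_onD[OF assms(1), of "1 - l" r "t + b"] l assms(2,3) eq by simp
  ultimately show ?thesis by (simp add: algebra_simps)
qed (use assms in auto)

section \<open>Elementary properties of the majorizing function\<close>

locale majorant =
  fixes h h' h'' :: "real \<Rightarrow> real" and R ts :: real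
  assumes deriv_h: "t \<in> {0..<R} \<Longrightarrow> (h has_real_derivative h' t) (at t within {0..<R})"
    and deriv_h': "t \<in> {0..<R} \<Longrightarrow> (h' has_real_derivative h'' t) (at t within {0..<R})"
    and h_0: "h 0 > 0" and h'_0: "h' 0 = -1" and h''_0: "h'' 0 > 0"
    and convex_h'': "convex_on {0..<R} h''"
    and strict_mono_h'': "strict_mono_on {0..<R} h''"
    and smallest_zero: "is_smallest_zero h R ts"
    and h'_ts: "h' ts < 0"
begin

lemma ts: "0 < ts" "ts < R" "h ts = 0"
  using smallest_zero by (auto simp: is_smallest_zero_def)

text \<open>The monotonicity criteria below use two-sided derivatives on open intervals, together
  with continuity up to the end points; the one-sided derivative at \<open>0\<close> enters only
  through continuity.\<close>

lemma DERIV_interior: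
  assumes "0 < t" "t < R"
  shows "DERIV h t :> h' t" "DERIV h' t :> h'' t"
proof -
  have "at t within {0..<R} = at t"
    using assms by (intro at_within_interior) auto
  then show "DERIV h t :> h' t" "DERIV h' t :> h'' t"
    using deriv_h[of t] deriv_h'[of t] assms by auto
qed

lemma continuous_on_h: "continuous_on {0..<R} h" "continuous_on {0..<R} h'"
  unfolding continuous_on_eq_continuous_within
  using deriv_h deriv_h' DERIV_continuous by blast+

lemma continuous_on_subinterval:
  assumes "0 \<le> a" "b < R"
  shows "continuous_on {a..b} h" "continuous_on {a..b} h'"
  by (rule continuous_on_subset[OF continuous_on_h(1)]; use assms in auto)
     (rule continuous_on_subset[OF continuous_on_h(2)]; use assms in auto)

lemma h''_mono: "0 \<le> a \<Longrightarrow> a \<le> b \<Longrightarrow> b < R \<Longrightarrow> h'' a \<le> h'' b"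
  using strict_mono_onD[OF strict_mono_h'', of a b] by (cases "a = b") auto

lemma h''_pos: "0 \<le> a \<Longrightarrow> a < R \<Longrightarrow> h'' a > 0"
  using h''_mono[of 0 a] h''_0 by auto

lemma h'_mono:
  assumes "0 \<le> a" "a \<le> b" "b < R" shows "h' a \<le> h' b"
  using assms
  by (intro DERIV_nonneg_imp_increasing_open[OF assms(2)] continuous_on_subinterval)
     (auto intro!: exI[of _ "h'' _"] DERIV_interior less_imp_le[OF h''_pos])

lemma h'_neg: "0 \<le> a \<Longrightarrow> a \<le> ts \<Longrightarrow> h' a < 0"
  using h'_mono[of a ts] h'_ts ts by auto

lemma h'_ge: "0 \<le> a \<Longrightarrow> a < R \<Longrightarrow> -1 \<le> h' a"
  using h'_mono[of 0 a] h'_0 by auto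

text \<open>As \<open>h 0 > 0\<close>, a nonpositive value before \<open>ts\<close> would give an
  earlier zero by the intermediate value theorem.\<close>

lemma h_pos:
  assumes "0 \<le> a" "a < ts" shows "h a > 0"
proof (rule ccontr)
  assume "\<not> h a > 0"
  then have "\<exists>x\<ge>0. x \<le> a \<and> h x = 0"
    using assms h_0 ts by (intro IVT2' continuous_on_subinterval) auto
  then obtain x where x: "0 \<le> x" "x \<le> a" "h x = 0" by blast
  moreover have "x \<noteq> 0" using x h_0 by auto
  ultimately show False using smallest_zero assms ts(2) unfolding is_smallest_zero_def
    by (metis greaterThanLessThan_iff less_eq_real_def not_le order.strict_trans1 order.strict_trans2)
qed

text \<open>Since \<open>h''\<close> is increasing, \<open>h'\<close> minus its tangent at
  \<open>a\<close> has nonnegative derivative to the right of \<open>a\<close>.\<close>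

lemma h'_first_order:
  assumes "0 \<le> a" "a \<le> b" "b < R" shows "h' a + h'' a * (b - a) \<le> h' b"
proof -
  have "h' a - h'' a * (a - a) \<le> h' b - h'' a * (b - a)"
  proof (rule DERIV_nonneg_imp_increasing_open[OF assms(2)])
    fix x assume x: "a < x" "x < b"
    have "DERIV (\<lambda>u. h' u - h'' a * (u - a)) x :> h'' x - h'' a"
      using x assms by (auto intro!: derivative_eq_intros DERIV_interior)
    then show "\<exists>y. DERIV (\<lambda>u. h' u - h'' a * (u - a)) x :> y \<and> 0 \<le> y"
      using h''_mono[of a x] x assms by auto
  qed (use assms in \<open>auto intro!: continuous_intros continuous_on_subinterval\<close>)
  then show ?thesis by simp
qed

text \<open>Integrates \<open>h'_first_order\<close> once more; applied with \<open>b = ts\<close>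
  it prevents the scalar step from overshooting.\<close>

lemma h_second_order:
  assumes "0 \<le> a" "a \<le> b" "b < R"
  shows "h a + h' a * (b - a) + h'' a / 2 * (b - a)^2 \<le> h b"
proof -
  have "h a - h' a * (a - a) - h'' a / 2 * (a - a)^2 \<le> h b - h' a * (b - a) - h'' a / 2 * (b - a)^2"
  proof (rule DERIV_nonneg_imp_increasing_open[OF assms(2)])
    fix x assume x: "a < x" "x < b"
    have "DERIV (\<lambda>u. h u - h' a * (u - a) - h'' a / 2 * (u - a)^2) x :> h' x - h' a - h'' a * (x - a)"
      using x assms by (auto intro!: derivative_eq_intros DERIV_interior)
    then show "\<exists>y. DERIV (\<lambda>u. h u - h' a * (u - a) - h'' a / 2 * (u - a)^2) x :> y \<and> 0 \<le> y"
      using h'_first_order[of a x] x assms by auto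
  qed (use assms in \<open>auto intro!: continuous_intros continuous_on_subinterval\<close>)
  then show ?thesis by simp
qed

text \<open>Gives \<open>scalar_L \<le> 1/4\<close> without assuming a third derivative of \<open>h\<close>.\<close>

lemma h_h''_le:
  assumes "0 \<le> a" "a \<le> ts" shows "2 * h'' a * h a \<le> (h' a)^2"
proof -
  \<comment> \<open>Freezing \<open>h''\<close> at \<open>a\<close> makes
    \<open>(h')^2 - 2 * h'' a * h\<close> differentiable. It decreases on \<open>{a..ts}\<close>
    because \<open>h'\<close> is negative and \<open>h''\<close> increases, and its value at
    \<open>ts\<close> is a square.\<close>
  have "(h' ts)^2 - 2 * h'' a * h ts \<le> (h' a)^2 - 2 * h'' a * h a"
  proof (rule DERIV_nonpos_imp_decreasing_open[OF assms(2)])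
    fix x assume x: "a < x" "x < ts"
    have "DERIV (\<lambda>u. (h' u)^2 - 2 * h'' a * h u) x :> 2 * h' x * (h'' x - h'' a)"
      by (rule derivative_eq_intros DERIV_interior refl | use x assms ts in \<open>simp add: algebra_simps\<close>)+
    moreover have "2 * h' x * (h'' x - h'' a) \<le> 0"
      by (rule mult_nonpos_nonneg) (use h'_neg[of x] h''_mono[of a x] x assms ts in auto)
    ultimately show "\<exists>y. DERIV (\<lambda>u. (h' u)^2 - 2 * h'' a * h u) x :> y \<and> y \<le> 0" by blast
  qed (use assms ts in \<open>auto intro!: continuous_intros continuous_on_subinterval\<close>)
  then have "(h' ts)^2 + 2 * h'' a * h a \<le> (h' a)^2" using ts(3) by simp
  then show ?thesis using zero_le_power2[of "h' ts"] by linarith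
qed

section \<open>The scalar Halley iteration for \<open>h\<close>\<close>

definition newton_len :: "real \<Rightarrow> real" where "newton_len t = - h t / h' t"

definition scalar_L :: "real \<Rightarrow> real" where "scalar_L t = h t * h'' t / (2 * (h' t)^2)"

definition halley_len :: "real \<Rightarrow> real" where "halley_len t = newton_len t / (1 - scalar_L t)"

context
  fixes t assumes t: "0 \<le> t" "t < ts"
begin

lemma newton_len_pos: "newton_len t > 0"
  using h_pos[OF t] h'_neg[of t] t by (auto simp: newton_len_def divide_pos_neg)

lemma scalar_L_bounds: "0 \<le> scalar_L t" "scalar_L t < 1"
proof -
  have "h' t \<noteq> 0" using h'_neg[of t] t by auto
  then have "(h' t)^2 > 0" by simp
  moreover have "0 < h t * h'' t"
    using h_pos[OF t] h''_pos[of t] t ts by simp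
  ultimately show "0 \<le> scalar_L t" "scalar_L t < 1"
    using h_h''_le[of t] t by (auto simp: scalar_L_def field_simps)
qed

lemma newton_len_le_halley_len: "newton_len t \<le> halley_len t"
  using newton_len_pos scalar_L_bounds by (auto simp: halley_len_def field_simps)

lemma halley_len_ge_h: "h t \<le> halley_len t"
proof -
  have "h t \<le> newton_len t"
    using h_pos[OF t] h'_neg[of t] h'_ge[of t] t ts mult_left_mono[of "- h' t" 1 "h t"]
    by (auto simp: newton_len_def field_simps)
  then show ?thesis using newton_len_le_halley_len by linarith
qed

lemma scalar_L_halley_len: "scalar_L t * halley_len t = halley_len t - newton_len t"
  using scalar_L_bounds by (auto simp: halley_len_def field_simps)

text \<open>The defining equation of a Halley step with denominators cleared: a second-order Taylor
  model in which one factor of the quadratic term is the Newton step. In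
  \<open>F_halley_step_le\<close> it cancels everything but
  \<open>h (t + halley_len t)\<close>.\<close>

lemma halley_len_eq:
  "h t + h' t * halley_len t + h'' t / 2 * newton_len t * halley_len t = 0"
proof -
  have n0: "h' t \<noteq> 0" using h'_neg[of t] t by auto
  have "h'' t / 2 * newton_len t = - h' t * scalar_L t"
    using n0 by (simp add: newton_len_def scalar_L_def field_simps power2_eq_square)
  then have "h' t * halley_len t + h'' t / 2 * newton_len t * halley_len t
      = h' t * halley_len t - h' t * (scalar_L t * halley_len t)" by simp
  also have "\<dots> = h' t * newton_len t" unfolding scalar_L_halley_len by (simp add: algebra_simps)
  also have "\<dots> = - h t" using n0 by (simp add: newton_len_def)
  finally show ?thesis by simp
qed

text \<open>Let \<open>n = newton_len t\<close> and let \<open>s\<close> be the gap to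
  \<open>ts\<close>. The affine function with value \<open>h t > 0\<close> at \<open>0\<close> and
  slope \<open>h' t + h'' t / 2 * n\<close> vanishes at \<open>halley_len t\<close>, hence is
  decreasing. If \<open>s \<le> halley_len t\<close>, it is nonnegative at \<open>s\<close>; but
  \<open>n < s\<close>, so the Taylor polynomial at \<open>s\<close> would be positive, whereas it
  is at most \<open>h ts = 0\<close>.\<close>

lemma halley_len_less: "t + halley_len t < ts"
proof (rule ccontr)
  define s where "s = ts - t"
  have s: "s > 0" using t by (simp add: s_def)
  assume "\<not> t + halley_len t < ts"
  then have le: "s \<le> halley_len t" by (simp add: s_def)
  have h'': "h'' t > 0" using h''_pos[of t] t ts by auto
  have h': "h' t < 0" using h'_neg[of t] t by auto
  have taylor: "h t + h' t * s + h'' t / 2 * s^2 \<le> 0"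
    using h_second_order[of t ts] t ts by (simp add: s_def)
  moreover have "h'' t / 2 * s^2 > 0" using s h'' by simp
  ultimately have "h t < - h' t * s" by linarith
  then have ns: "newton_len t < s" using h' by (simp add: newton_len_def field_simps)
  have "h' t + h'' t / 2 * newton_len t < 0"
  proof (rule ccontr)
    assume "\<not> ?thesis"
    then have "0 \<le> (h' t + h'' t / 2 * newton_len t) * halley_len t"
      using le s by (intro mult_nonneg_nonneg) auto
    then show False using halley_len_eq h_pos[OF t] by (simp add: algebra_simps)
  qed
  then have "(h' t + h'' t / 2 * newton_len t) * halley_len t \<le> (h' t + h'' t / 2 * newton_len t) * s"
    using le by (intro mult_left_mono_neg) auto
  then have "0 \<le> h t + h' t * s + h'' t / 2 * newton_len t * s"
    using halley_len_eq by (simp add: algebra_simps)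
  moreover have "h'' t / 2 * newton_len t * s < h'' t / 2 * s^2"
    using ns h'' s by (simp add: power2_eq_square)
  ultimately show False using taylor by linarith
qed

end

definition scalar_seq :: "nat \<Rightarrow> real" where
  "scalar_seq k = ((\<lambda>t. t + halley_len t) ^^ k) 0"

lemma scalar_seq_simps [simp]:
  "scalar_seq 0 = 0" "scalar_seq (Suc k) = scalar_seq k + halley_len (scalar_seq k)"
  by (simp_all add: scalar_seq_def)

lemma scalar_seq_bounds: "0 \<le> scalar_seq k" "scalar_seq k < ts"
proof (induction k)
  case (Suc k)
  show "0 \<le> scalar_seq (Suc k)"
    using Suc newton_len_pos newton_len_le_halley_len by fastforce
  show "scalar_seq (Suc k) < ts" using Suc halley_len_less by simp
qed (use ts in auto)

lemma convergent_scalar_seq: "convergent scalar_seq"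
proof (rule Bseq_monoseq_convergent)
  show "Bseq scalar_seq"
    by (rule BseqI'[of _ ts]) (use scalar_seq_bounds in \<open>auto simp: less_imp_le\<close>)
  have "scalar_seq k \<le> scalar_seq (Suc k)" for k
    using newton_len_pos[of "scalar_seq k"] newton_len_le_halley_len[of "scalar_seq k"]
      scalar_seq_bounds[of k] by simp
  then show "monoseq scalar_seq" by (simp add: mono_SucI1)
qed

lemma halley_len_scalar_seq_tendsto: "(\<lambda>k. halley_len (scalar_seq k)) \<longlonglongrightarrow> 0"
proof -
  obtain l where l: "scalar_seq \<longlonglongrightarrow> l" using convergent_scalar_seq by (auto simp: convergent_def)
  have "(\<lambda>k. scalar_seq (Suc k) - scalar_seq k) \<longlonglongrightarrow> l - l"
    by (intro tendsto_diff LIMSEQ_Suc l)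
  then show ?thesis by simp
qed

lemma h_scalar_seq_tendsto: "(\<lambda>k. h (scalar_seq k)) \<longlonglongrightarrow> 0"
proof (rule tendsto_sandwich[OF _ _ tendsto_const halley_len_scalar_seq_tendsto])
  show "\<forall>\<^sub>F k in sequentially. 0 \<le> h (scalar_seq k)"
    using h_pos scalar_seq_bounds by (auto simp: less_imp_le)
  show "\<forall>\<^sub>F k in sequentially. h (scalar_seq k) \<le> halley_len (scalar_seq k)"
    using halley_len_ge_h scalar_seq_bounds by auto
qed

end

section \<open>Composition identities and derivatives along a line\<close>

lemma compose_eq_id_apply: "A o\<^sub>L B = id_blinfun \<Longrightarrow> A (B x) = x"
  by (metis blinfun_apply_blinfun_compose blinfun_apply_id_blinfun)

lemma blinfun_apply_bilin_compose: "blinfun_apply (bilin_compose G B) u = G o\<^sub>L B u"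
  by (rule blinfun_eqI) (simp add: bilin_compose_apply)

lemma bilin_compose_diff: "bilin_compose G (A - B) = bilin_compose G A - bilin_compose G B"
  by (intro blinfun_eqI) (simp add: bilin_compose_apply blinfun.diff_left blinfun.diff_right)

lemma has_vector_derivative_along_line:
  fixes g :: "'a::real_normed_vector \<Rightarrow> 'b::real_normed_vector" and \<theta> :: real
  assumes "(g has_derivative g') (at (x + \<theta> *\<^sub>R v))"
  shows "((\<lambda>\<theta>. g (x + \<theta> *\<^sub>R v)) has_vector_derivative g' v) (at \<theta>)"
proof -
  have "((\<lambda>\<theta>. x + \<theta> *\<^sub>R v) has_derivative (\<lambda>\<tau>. \<tau> *\<^sub>R v)) (at \<theta>)"
    by (auto intro!: derivative_eq_intros)
  from has_derivative_compose[OF this assms]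
  have "((\<lambda>\<theta>. g (x + \<theta> *\<^sub>R v)) has_derivative (\<lambda>\<tau>. g' (\<tau> *\<^sub>R v))) (at \<theta>)" .
  moreover have "g' (\<tau> *\<^sub>R v) = \<tau> *\<^sub>R g' v" for \<tau>
    using assms has_derivative_bounded_linear linear_simps(5) by blast
  ultimately show ?thesis by (simp add: has_vector_derivative_def)
qed

lemma continuous_on_vector_derivative:
  assumes "\<And>\<theta>::real. \<theta> \<in> S \<Longrightarrow> (f has_vector_derivative f' \<theta>) (at \<theta>)"
  shows "continuous_on S f"
  using assms by (meson continuous_at_imp_continuous_on has_vector_derivative_continuous)

section \<open>Bounds on the operator and its derivatives by the majorant\<close>

locale majorized_operator = majorant h h' h'' R ts
  for h h' h'' :: "real \<Rightarrow> real" and R ts :: real +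
  fixes F :: "'a::banach \<Rightarrow> 'b::banach"
    and F' :: "'a \<Rightarrow> 'a \<Rightarrow>\<^sub>L 'b"
    and F'' :: "'a \<Rightarrow> 'a \<Rightarrow>\<^sub>L 'a \<Rightarrow>\<^sub>L 'b"
    and x0 :: 'a
  assumes deriv_F: "x \<in> ball x0 R \<Longrightarrow> (F has_derivative F' x) (at x)"
    and deriv_F': "x \<in> ball x0 R \<Longrightarrow> (F' has_derivative F'' x) (at x)"
    and invertible_x0: "boundedly_invertible (F' x0)"
    and majorized: "x \<in> ball x0 R \<Longrightarrow> y \<in> ball x0 R \<Longrightarrow> norm (y - x) + norm (x - x0) < R \<Longrightarrow>
        norm (bilin_compose (blinfun_inv (F' x0)) (F'' y - F'' x))
          \<le> h'' (norm (y - x) + norm (x - x0)) - h'' (norm (x - x0))"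
    and F_x0: "norm (blinfun_inv (F' x0) (F x0)) \<le> h 0"
    and F''_x0: "norm (bilin_compose (blinfun_inv (F' x0)) (F'' x0)) \<le> h'' 0"
begin

abbreviation \<Gamma> :: "'b \<Rightarrow>\<^sub>L 'a" where "\<Gamma> \<equiv> blinfun_inv (F' x0)"

lemma \<Gamma>_inverse: "\<Gamma> (F' x0 v) = v" "F' x0 (\<Gamma> w) = w"
  by (simp_all only: compose_eq_id_apply blinfun_inv_inverse[OF invertible_x0])

text \<open>The majorant condition based at \<open>x0\<close> controls the change from
  \<open>F'' x0\<close>; adding the bound at \<open>x0\<close> cancels \<open>h'' 0\<close>.\<close>

lemma norm_F''_le:
  assumes "norm (x - x0) \<le> t" "t < R"
  shows "norm (bilin_compose \<Gamma> (F'' x)) \<le> h'' t"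
proof -
  have "norm (bilin_compose \<Gamma> (F'' x - F'' x0)) \<le> h'' (norm (x - x0)) - h'' 0"
    using majorized[of x0 x] assms ts by (simp add: dist_norm norm_minus_commute)
  moreover have "h'' (norm (x - x0)) \<le> h'' t" using assms by (intro h''_mono) auto
  ultimately show ?thesis using F''_x0 unfolding bilin_compose_diff
    by (smt (verit) norm_triangle_sub)
qed

text \<open>Mean value inequality on the segment from \<open>x0\<close> to \<open>x\<close>, with
  \<open>\<lambda>\<theta>. h' (\<theta> * norm v)\<close> as comparison function; the summand
  \<open>1\<close> is \<open>- h' 0\<close>. For \<open>x = x0\<close> the comparison argument would
  stay at \<open>0\<close>, where \<open>h'\<close> has only a one-sided derivative.\<close>

lemma norm_id_minus_F'_le:
  assumes "norm (x - x0) \<le> t" "t < R"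
  shows "norm (id_blinfun - (\<Gamma> o\<^sub>L F' x)) \<le> 1 + h' t"
proof (cases "x = x0")
  case True
  then show ?thesis
    using h'_ge[of t] assms blinfun_inv_inverse(1)[OF invertible_x0] by auto
next
  case False
  define v where "v = x - x0"
  have r: "norm v > 0" "norm v \<le> t" using False assms by (auto simp: v_def)
  have in_ball: "norm (\<theta> *\<^sub>R v) \<le> \<theta> * norm v \<and> \<theta> * norm v < R"
    if "0 \<le> \<theta>" "\<theta> \<le> 1" for \<theta>
  proof -
    have "\<theta> * norm v \<le> norm v" using that by (simp add: mult_left_le_one_le)
    then show ?thesis using that r(2) assms(2) by simp
  qed
  have deriv: "((\<lambda>\<theta>. \<Gamma> o\<^sub>L F' (x0 + \<theta> *\<^sub>R v)) has_vector_derivative \<Gamma> o\<^sub>L F'' (x0 + \<theta> *\<^sub>R v) v) (at \<theta>)"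
    if "0 \<le> \<theta>" "\<theta> \<le> 1" for \<theta>
    by (rule bounded_linear.has_vector_derivative[OF
          bounded_bilinear.bounded_linear_right[OF bounded_bilinear_blinfun_compose]],
        rule has_vector_derivative_along_line, rule deriv_F')
       (use in_ball[OF that] in \<open>auto simp: dist_norm\<close>)
  have "norm ((\<Gamma> o\<^sub>L F' (x0 + 1 *\<^sub>R v)) - (\<Gamma> o\<^sub>L F' (x0 + 0 *\<^sub>R v)))
      \<le> h' (1 * norm v) - h' (0 * norm v)"
  proof (rule differentiable_bound_general)
    show "continuous_on {0..1} (\<lambda>\<theta>. \<Gamma> o\<^sub>L F' (x0 + \<theta> *\<^sub>R v))"
      by (rule continuous_on_vector_derivative, rule deriv) auto
    show "continuous_on {0..1} (\<lambda>\<theta>. h' (\<theta> * norm v))"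
      by (rule continuous_on_compose2[OF continuous_on_h(2)])
         (use in_ball in \<open>auto intro!: continuous_intros\<close>)
    fix \<theta> :: real assume \<theta>: "0 < \<theta>" "\<theta> < 1"
    show "((\<lambda>\<theta>. \<Gamma> o\<^sub>L F' (x0 + \<theta> *\<^sub>R v)) has_vector_derivative \<Gamma> o\<^sub>L F'' (x0 + \<theta> *\<^sub>R v) v) (at \<theta>)"
      using \<theta> deriv by simp
    have "DERIV (\<lambda>\<theta>. h' (\<theta> * norm v)) \<theta> :> h'' (\<theta> * norm v) * norm v"
      by (rule DERIV_chain2[OF DERIV_interior(2)])
         (use \<theta> r in_ball[of \<theta>] in \<open>auto intro!: derivative_eq_intros\<close>)
    then show "((\<lambda>\<theta>. h' (\<theta> * norm v)) has_vector_derivative h'' (\<theta> * norm v) * norm v) (at \<theta>)"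
      by (simp add: has_real_derivative_iff_has_vector_derivative)
    have "norm (\<Gamma> o\<^sub>L F'' (x0 + \<theta> *\<^sub>R v) v) \<le> norm (bilin_compose \<Gamma> (F'' (x0 + \<theta> *\<^sub>R v))) * norm v"
      by (metis blinfun_apply_bilin_compose norm_blinfun)
    also have "\<dots> \<le> h'' (\<theta> * norm v) * norm v"
      using in_ball[of \<theta>] \<theta> by (intro mult_right_mono norm_F''_le) auto
    finally show "norm (\<Gamma> o\<^sub>L F'' (x0 + \<theta> *\<^sub>R v) v) \<le> h'' (\<theta> * norm v) * norm v" .
  qed simp
  then have "norm ((\<Gamma> o\<^sub>L F' x) - id_blinfun) \<le> h' (norm v) + 1"
    using blinfun_inv_inverse(1)[OF invertible_x0] h'_0 by (simp add: v_def)
  also have "h' (norm v) \<le> h' t" using r assms by (intro h'_mono) auto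
  finally show ?thesis by (simp add: norm_minus_commute)
qed

text \<open>The mean value inequality is applied twice along the segment from \<open>x\<close> to
  \<open>x + d\<close>, starting from a comparison of second derivatives.\<close>

lemma taylor_remainder_le:
  assumes "norm (x - x0) \<le> t" "norm d \<le> s" "0 < s" "t + s < R"
  shows "norm (\<Gamma> (F (x + d)) - \<Gamma> (F x) - \<Gamma> (F' x d) - (1/2) *\<^sub>R \<Gamma> (F'' x d d))
    \<le> h (t + s) - h t - h' t * s - h'' t / 2 * s^2"
proof -
  have t: "0 \<le> t" using assms(1) norm_ge_zero order_trans by blast
  \<comment> \<open>\<open>p1\<close> and \<open>p2\<close> are the first two derivatives of
    \<open>p\<close>, and \<open>q\<close>, \<open>q1\<close>, \<open>q2\<close> are the scalar
    counterparts. The two sides of the claim are the norm of \<open>p 1 - p 0\<close> and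
    \<open>q 1 - q 0\<close>.\<close>
  define p where "p \<theta> = \<Gamma> (F (x + \<theta> *\<^sub>R d)) - \<theta> *\<^sub>R \<Gamma> (F' x d) - (\<theta>^2 / 2) *\<^sub>R \<Gamma> (F'' x d d)" for \<theta>
  define p1 where "p1 \<theta> = \<Gamma> (F' (x + \<theta> *\<^sub>R d) d) - \<Gamma> (F' x d) - \<theta> *\<^sub>R \<Gamma> (F'' x d d)" for \<theta>
  define p2 where "p2 \<theta> = \<Gamma> (F'' (x + \<theta> *\<^sub>R d) d d) - \<Gamma> (F'' x d d)" for \<theta>
  define q where "q \<theta> = h (t + \<theta> * s) - \<theta> * (h' t * s) - \<theta>^2 / 2 * (h'' t * s^2)" for \<theta>
  define q1 where "q1 \<theta> = h' (t + \<theta> * s) * s - h' t * s - \<theta> * (h'' t * s^2)" for \<theta>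
  define q2 where "q2 \<theta> = (h'' (t + \<theta> * s) - h'' t) * s^2" for \<theta>
  have \<theta>s: "\<theta> * norm d \<le> \<theta> * s \<and> t + \<theta> * s < R \<and> 0 \<le> \<theta> * s" if "0 \<le> \<theta>" "\<theta> \<le> 1" for \<theta>
  proof -
    have "\<theta> * s \<le> s" using that assms(3) by (simp add: mult_left_le_one_le)
    then have "t + \<theta> * s < R" using assms(4) by linarith
    then show ?thesis using that assms by (simp add: mult_left_mono)
  qed
  have in_ball: "x + \<theta> *\<^sub>R d \<in> ball x0 R" if "0 \<le> \<theta>" "\<theta> \<le> 1" for \<theta>
  proof -
    have "norm (x + \<theta> *\<^sub>R d - x0) \<le> norm (x - x0) + \<theta> * norm d"
      using norm_triangle_ineq[of "x - x0" "\<theta> *\<^sub>R d"] that by (simp add: algebra_simps)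
    then show ?thesis using \<theta>s[OF that] assms by (simp add: dist_norm norm_minus_commute)
  qed
  have p_deriv: "(p has_vector_derivative p1 \<theta>) (at \<theta>)" if "0 \<le> \<theta>" "\<theta> \<le> 1" for \<theta>
  proof -
    have "((\<lambda>\<theta>. \<Gamma> (F (x + \<theta> *\<^sub>R d))) has_vector_derivative \<Gamma> (F' (x + \<theta> *\<^sub>R d) d)) (at \<theta>)"
      by (rule bounded_linear.has_vector_derivative[OF blinfun.bounded_linear_right],
          rule has_vector_derivative_along_line, rule deriv_F, rule in_ball[OF that])
    then show ?thesis unfolding p_def p1_def
      by (auto intro!: derivative_eq_intros)
  qed
  have p1_deriv: "(p1 has_vector_derivative p2 \<theta>) (at \<theta>)" if "0 \<le> \<theta>" "\<theta> \<le> 1" for \<theta>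
  proof -
    have "((\<lambda>\<theta>. \<Gamma> (F' (x + \<theta> *\<^sub>R d) d)) has_vector_derivative \<Gamma> (F'' (x + \<theta> *\<^sub>R d) d d)) (at \<theta>)"
      by (rule bounded_linear.has_vector_derivative[OF blinfun.bounded_linear_right],
          rule bounded_linear.has_vector_derivative[OF blinfun.bounded_linear_left],
          rule has_vector_derivative_along_line, rule deriv_F', rule in_ball[OF that])
    then show ?thesis unfolding p1_def p2_def
      by (auto intro!: derivative_eq_intros)
  qed
  \<comment> \<open>Strict positivity of \<open>\<theta>\<close> keeps
    \<open>t + \<theta> * s\<close> away from \<open>0\<close> even when
    \<open>t = 0\<close>.\<close>
  have h_deriv: "DERIV (\<lambda>\<theta>. h (t + \<theta> * s)) \<theta> :> h' (t + \<theta> * s) * s"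
    "DERIV (\<lambda>\<theta>. h' (t + \<theta> * s)) \<theta> :> h'' (t + \<theta> * s) * s" if "0 < \<theta>" "\<theta> < 1" for \<theta>
    by (rule DERIV_chain2[OF DERIV_interior(1)] DERIV_chain2[OF DERIV_interior(2)],
        use that \<theta>s[of \<theta>] t assms(3) in \<open>auto intro!: derivative_eq_intros add_nonneg_pos\<close>)+
  have q_deriv: "(q has_vector_derivative q1 \<theta>) (at \<theta>)"
    "(q1 has_vector_derivative q2 \<theta>) (at \<theta>)" if "0 < \<theta>" "\<theta> < 1" for \<theta>
    unfolding has_real_derivative_iff_has_vector_derivative[symmetric] q_def q1_def q2_def
    by (auto intro!: derivative_eq_intros h_deriv[OF that] simp: algebra_simps power2_eq_square)
  have q_cont: "continuous_on {0..1} q" "continuous_on {0..1} q1"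
    unfolding q_def q1_def
    by (intro continuous_intros continuous_on_compose2[OF continuous_on_h(1)]
          continuous_on_compose2[OF continuous_on_h(2)]; use \<theta>s t in force)+
  have p2_le: "norm (p2 \<theta>) \<le> q2 \<theta>" if \<theta>: "0 \<le> \<theta>" "\<theta> \<le> 1" for \<theta>
  proof -
    define r where "r = norm (x - x0)"
    have r: "0 \<le> r" "r \<le> t" using assms(1) by (auto simp: r_def)
    note b = \<theta>s[OF \<theta>]
    have "norm (bilin_compose \<Gamma> (F'' (x + \<theta> *\<^sub>R d) - F'' x)) \<le> h'' (\<theta> * norm d + r) - h'' r"
      using majorized[of x "x + \<theta> *\<^sub>R d"] in_ball[OF \<theta>] in_ball[of 0] b r \<theta>(1)
      by (simp add: r_def)
    also have "\<dots> \<le> h'' (r + \<theta> * s) - h'' r"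
      using b r \<theta>(1) by (intro diff_right_mono h''_mono) auto
    \<comment> \<open>Convexity of \<open>h''\<close> replaces the true radius \<open>r\<close> by
      its bound \<open>t\<close>.\<close>
    also have "\<dots> \<le> h'' (t + \<theta> * s) - h'' t"
      by (rule convex_on_diff_mono[OF convex_h'']) (use b r t in auto)
    finally have B: "norm (bilin_compose \<Gamma> (F'' (x + \<theta> *\<^sub>R d) - F'' x)) \<le> h'' (t + \<theta> * s) - h'' t" .
    have "p2 \<theta> = bilin_compose \<Gamma> (F'' (x + \<theta> *\<^sub>R d) - F'' x) d d"
      by (simp add: p2_def bilin_compose_apply blinfun.diff_left blinfun.diff_right)
    then have "norm (p2 \<theta>) \<le> norm (bilin_compose \<Gamma> (F'' (x + \<theta> *\<^sub>R d) - F'' x)) * norm d * norm d"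
      by (simp add: norm_bilin_apply_le)
    also have "\<dots> \<le> (h'' (t + \<theta> * s) - h'' t) * s * s"
      by (intro mult_mono B assms mult_nonneg_nonneg order_trans[OF norm_ge_zero B])
         (use assms in auto)
    finally show ?thesis by (simp add: q2_def power2_eq_square algebra_simps)
  qed
  have p1_le: "norm (p1 \<theta>) \<le> q1 \<theta>" if \<theta>: "0 < \<theta>" "\<theta> \<le> 1" for \<theta>
  proof -
    \<comment> \<open>Both \<open>p1\<close> and \<open>q1\<close> vanish at \<open>0\<close>, so
      this bounds \<open>p1 \<theta>\<close> itself.\<close>
    have "norm (p1 \<theta> - p1 0) \<le> q1 \<theta> - q1 0"
    proof (rule differentiable_bound_general[OF \<theta>(1), where f' = p2 and \<phi>' = q2])
      show "continuous_on {0..\<theta>} p1"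
        by (rule continuous_on_vector_derivative, rule p1_deriv) (use \<theta> in auto)
      show "continuous_on {0..\<theta>} q1"
        by (rule continuous_on_subset[OF q_cont(2)]) (use \<theta> in auto)
    qed (use \<theta> p1_deriv q_deriv p2_le in auto)
    then show ?thesis by (simp add: p1_def q1_def)
  qed
  have "norm (p 1 - p 0) \<le> q 1 - q 0"
  proof (rule differentiable_bound_general[OF zero_less_one, where f' = p1 and \<phi>' = q1])
    show "continuous_on {0..1} p"
      by (rule continuous_on_vector_derivative, rule p_deriv) auto
  qed (use q_cont p_deriv q_deriv p1_le in auto)
  then show ?thesis by (simp add: p_def q_def algebra_simps)
qed

section \<open>One Halley step of the operator against one scalar step\<close>

definition halley_incr :: "'a \<Rightarrow> 'a" where
  "halley_incr x = - blinfun_inv (id_blinfun - halley_L F F' F'' x) (blinfun_inv (F' x) (F x))"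

context
  fixes x :: 'a and t :: real
  assumes t: "0 \<le> t" "t < ts" and x: "norm (x - x0) \<le> t" and Fx: "norm (\<Gamma> (F x)) \<le> h t"
begin

text \<open>By \<open>norm_id_minus_F'_le\<close>, \<open>\<Gamma> o\<^sub>L F' x\<close> is within
  \<open>1 + h' t < 1\<close> of the identity, so it has an inverse \<open>N\<close>. Writing the
  inverse of \<open>F' x\<close> as \<open>N o\<^sub>L \<Gamma>\<close> lets the available bounds,
  all stated after applying \<open>\<Gamma>\<close>, be used.\<close>

lemma
  shows boundedly_invertible_F': "boundedly_invertible (F' x)"
    and inverse_F'_factor: "\<exists>N. blinfun_inv (F' x) = N o\<^sub>L \<Gamma> \<and> norm N \<le> 1 / - h' t"
proof -
  define A where "A = id_blinfun - (\<Gamma> o\<^sub>L F' x)"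
  have A: "norm A \<le> 1 + h' t"
    unfolding A_def by (rule norm_id_minus_F'_le) (use t ts x in auto)
  have h': "h' t < 0" using h'_neg[of t] t by auto
  define N where "N = blinfun_inv (id_blinfun - A)"
  have bi: "boundedly_invertible (id_blinfun - A)"
    by (rule boundedly_invertible_id_minus) (use A h' in auto)
  have idA: "id_blinfun - A = \<Gamma> o\<^sub>L F' x" by (simp add: A_def)
  have N1: "N (\<Gamma> (F' x v)) = v" for v
    using compose_eq_id_apply[OF blinfun_inv_inverse(1)[OF bi], of v] by (simp add: N_def idA)
  have N2: "\<Gamma> (F' x (N v)) = v" for v
    using compose_eq_id_apply[OF blinfun_inv_inverse(2)[OF bi], of v] by (simp add: N_def idA)
  have 1: "(N o\<^sub>L \<Gamma>) o\<^sub>L F' x = id_blinfun"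
    by (rule blinfun_eqI) (simp add: N1)
  have 2: "F' x o\<^sub>L (N o\<^sub>L \<Gamma>) = id_blinfun"
  proof (rule blinfun_eqI)
    fix y
    \<comment> \<open>\<open>F' x0\<close> undoes the outer \<open>\<Gamma>\<close> on both
      sides.\<close>
    have "F' x0 (\<Gamma> (F' x (N (\<Gamma> y)))) = F' x0 (\<Gamma> y)" by (simp only: N2)
    then show "(F' x o\<^sub>L (N o\<^sub>L \<Gamma>)) y = id_blinfun y" by (simp add: \<Gamma>_inverse)
  qed
  show "boundedly_invertible (F' x)"
    using 1 2 unfolding boundedly_invertible_def by blast
  have "norm N \<le> 1 / (1 - norm A)"
    unfolding N_def by (rule norm_inv_id_minus_le) (use A h' in auto)
  also have "\<dots> \<le> 1 / - h' t" using A h' by (intro divide_left_mono) (auto intro: mult_pos_neg)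
  finally show "\<exists>N. blinfun_inv (F' x) = N o\<^sub>L \<Gamma> \<and> norm N \<le> 1 / - h' t"
    using blinfun_inv_eqI[OF 1 2] by blast
qed

lemma norm_newton_step_le: "norm (blinfun_inv (F' x) (F x)) \<le> newton_len t"
proof -
  obtain N where N: "blinfun_inv (F' x) = N o\<^sub>L \<Gamma>" "norm N \<le> 1 / - h' t"
    using inverse_F'_factor by blast
  have "norm (N (\<Gamma> (F x))) \<le> norm N * norm (\<Gamma> (F x))" by (rule norm_blinfun)
  also have "\<dots> \<le> 1 / - h' t * h t"
    using h'_neg[of t] t by (intro mult_mono N Fx) auto
  finally show ?thesis by (simp add: N newton_len_def)
qed

text \<open>With \<open>N o\<^sub>L \<Gamma>\<close> for the inverse, the bounds on
  \<open>N\<close>, on \<open>F''\<close> after applying \<open>\<Gamma>\<close>, and on the Newton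
  step multiply to exactly \<open>scalar_L t\<close>.\<close>

lemma norm_halley_L_le: "norm (halley_L F F' F'' x) \<le> scalar_L t"
proof -
  obtain N where N: "blinfun_inv (F' x) = N o\<^sub>L \<Gamma>" "norm N \<le> 1 / - h' t"
    using inverse_F'_factor by blast
  have h': "h' t < 0" using h'_neg[of t] t by auto
  have h'': "0 \<le> h'' t" using h''_pos[of t] t ts by auto
  define w where "w = blinfun_inv (F' x) (F x)"
  have "halley_L F F' F'' x = (1/2) *\<^sub>R (N o\<^sub>L bilin_compose \<Gamma> (F'' x) w)"
    unfolding halley_L_def w_def[symmetric] blinfun_apply_bilin_compose
    by (intro blinfun_eqI) (simp add: N(1) blinfun.scaleR_left)
  then have "norm (halley_L F F' F'' x) \<le> 1/2 * (norm N * norm (bilin_compose \<Gamma> (F'' x) w))"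
    by (simp add: norm_blinfun_compose)
  also have "norm (bilin_compose \<Gamma> (F'' x) w) \<le> norm (bilin_compose \<Gamma> (F'' x)) * norm w"
    by (rule norm_blinfun)
  also have "\<dots> \<le> h'' t * newton_len t"
    unfolding w_def using x t ts h''
    by (intro mult_mono norm_F''_le norm_newton_step_le) auto
  also have "norm N * (h'' t * newton_len t) \<le> 1 / - h' t * (h'' t * newton_len t)"
    using h'' newton_len_pos[OF t] by (intro mult_right_mono N) auto
  also have "1/2 * (1 / - h' t * (h'' t * newton_len t)) = scalar_L t"
    using h' by (simp add: newton_len_def scalar_L_def field_simps power2_eq_square)
  finally show ?thesis by (simp add: mult_left_mono)
qed

lemma boundedly_invertible_id_minus_halley_L:
  "boundedly_invertible (id_blinfun - halley_L F F' F'' x)"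
  by (rule boundedly_invertible_id_minus) (use norm_halley_L_le scalar_L_bounds[OF t] in linarith)

lemma norm_halley_incr_le: "norm (halley_incr x) \<le> halley_len t"
proof -
  let ?L = "halley_L F F' F'' x"
  note L = norm_halley_L_le scalar_L_bounds[OF t]
  have "norm (halley_incr x) \<le> norm (blinfun_inv (id_blinfun - ?L)) * norm (blinfun_inv (F' x) (F x))"
    by (simp add: halley_incr_def norm_blinfun)
  also have "norm (blinfun_inv (id_blinfun - ?L)) \<le> 1 / (1 - norm ?L)"
    using L by (intro norm_inv_id_minus_le) auto
  also have "\<dots> \<le> 1 / (1 - scalar_L t)"
    using L by (intro divide_left_mono) auto
  also have "1 / (1 - scalar_L t) * norm (blinfun_inv (F' x) (F x))
      \<le> 1 / (1 - scalar_L t) * newton_len t"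
    using L by (intro mult_left_mono norm_newton_step_le) auto
  also have "\<dots> = halley_len t" by (simp add: halley_len_def)
  finally show ?thesis by (simp add: mult_right_mono)
qed

lemma F_halley_step_le: "norm (\<Gamma> (F (x + halley_incr x))) \<le> h (t + halley_len t)"
proof -
  let ?L = "halley_L F F' F'' x" and ?s = "halley_len t"
  define d where "d = halley_incr x"
  define u where "u = - blinfun_inv (F' x) (F x)"
  have nd: "norm d \<le> ?s" unfolding d_def by (rule norm_halley_incr_le)
  have s: "0 < ?s" using newton_len_pos[OF t] newton_len_le_halley_len[OF t] by simp
  have h'': "0 \<le> h'' t" using h''_pos[of t] t ts by auto
  have "(id_blinfun - ?L) d = u"
    unfolding d_def halley_incr_def u_def blinfun.minus_right
    by (simp only: compose_eq_id_apply[OF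
          blinfun_inv_inverse(2)[OF boundedly_invertible_id_minus_halley_L]])
  then have du: "d - u = ?L d" by (auto simp: blinfun.diff_left algebra_simps)
  have inv: "F' x (blinfun_inv (F' x) w) = w" for w
    by (rule compose_eq_id_apply[OF blinfun_inv_inverse(2)[OF boundedly_invertible_F']])
  have Fu: "F' x u = - F x" by (simp add: u_def blinfun.minus_right inv)
  have "?L d = - ((1/2) *\<^sub>R blinfun_inv (F' x) (F'' x u d))"
    by (simp add: halley_L_def u_def blinfun.minus_right blinfun.minus_left blinfun.scaleR_left)
  then have "F' x (d - u) = - ((1/2) *\<^sub>R F'' x u d)"
    by (simp add: du blinfun.minus_right blinfun.scaleR_right inv)
  \<comment> \<open>Operator analogue of \<open>halley_len_eq\<close>, with \<open>u\<close> the
    Newton step and \<open>d\<close> the Halley step.\<close>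
  then have "F x + F' x d + (1/2) *\<^sub>R F'' x u d = 0"
    by (simp add: blinfun.diff_right Fu algebra_simps)
  then have "\<Gamma> (F x + F' x d + (1/2) *\<^sub>R F'' x u d) = 0" by simp
  then have \<Gamma>0: "\<Gamma> (F x) + \<Gamma> (F' x d) + (1/2) *\<^sub>R \<Gamma> (F'' x u d) = 0"
    by (simp add: blinfun.add_right blinfun.scaleR_right)
  have "\<Gamma> (F'' x d d) = \<Gamma> (F'' x (d - u) d) + \<Gamma> (F'' x u d)"
    by (simp add: blinfun.diff_right blinfun.diff_left)
  then have half: "(1/2) *\<^sub>R \<Gamma> (F'' x d d) =
      (1/2) *\<^sub>R \<Gamma> (F'' x (d - u) d) + (1/2) *\<^sub>R \<Gamma> (F'' x u d)"
    by (simp add: scaleR_add_right)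
  \<comment> \<open>The Halley equation has \<open>F'' x u d\<close> where Taylor's formula has
    \<open>F'' x d d\<close>; the last term is this discrepancy.\<close>
  have split: "\<Gamma> (F (x + d)) =
      (\<Gamma> (F (x + d)) - \<Gamma> (F x) - \<Gamma> (F' x d) - (1/2) *\<^sub>R \<Gamma> (F'' x d d))
      + (1/2) *\<^sub>R \<Gamma> (F'' x (d - u) d)"
    unfolding half using \<Gamma>0 by (simp add: algebra_simps)
  have taylor: "norm (\<Gamma> (F (x + d)) - \<Gamma> (F x) - \<Gamma> (F' x d) - (1/2) *\<^sub>R \<Gamma> (F'' x d d))
      \<le> h (t + ?s) - h t - h' t * ?s - h'' t / 2 * ?s^2"
    by (rule taylor_remainder_le) (use x nd s halley_len_less[OF t] ts in auto)
  have "norm (d - u) \<le> scalar_L t * ?s"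
    unfolding du using nd s scalar_L_bounds[OF t]
    by (intro order_trans[OF norm_blinfun] mult_mono norm_halley_L_le) auto
  then have ndu: "norm (d - u) \<le> ?s - newton_len t" unfolding scalar_L_halley_len[OF t] .
  have "norm (\<Gamma> (F'' x (d - u) d)) \<le> norm (bilin_compose \<Gamma> (F'' x)) * norm (d - u) * norm d"
    using norm_bilin_apply_le[of "bilin_compose \<Gamma> (F'' x)" "d - u" d] by (simp add: bilin_compose_apply)
  also have "\<dots> \<le> h'' t * (?s - newton_len t) * ?s"
    using h'' newton_len_le_halley_len[OF t] x t ts
    by (intro mult_mono norm_F''_le nd ndu) auto
  finally have "norm ((1/2) *\<^sub>R \<Gamma> (F'' x (d - u) d)) \<le> 1/2 * (h'' t * (?s - newton_len t) * ?s)"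
    by simp
  then have "norm (\<Gamma> (F (x + d))) \<le> h (t + ?s) - h t - h' t * ?s - h'' t / 2 * ?s^2
      + 1/2 * (h'' t * (?s - newton_len t) * ?s)"
    using norm_triangle_le[OF add_mono[OF taylor]] split by metis
  \<comment> \<open>The quadratic terms in \<open>?s\<close> cancel, leaving the expression that
    \<open>halley_len_eq\<close> makes zero.\<close>
  also have "\<dots> = h (t + ?s) - (h t + h' t * ?s + h'' t / 2 * newton_len t * ?s)"
    by (simp add: algebra_simps power2_eq_square)
  also have "\<dots> = h (t + ?s)" using halley_len_eq[OF t] by simp
  finally show ?thesis by (simp add: d_def)
qed

end

section \<open>Convergence of the Halley sequence to a zero\<close>

abbreviation X :: "nat \<Rightarrow> 'a" where "X \<equiv> halley_seq F F' F'' x0"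

lemma halley_seq_Suc: "X (Suc k) = X k + halley_incr (X k)"
  by (simp add: Let_def halley_incr_def)

lemma halley_seq_invariant:
  "norm (X k - x0) \<le> scalar_seq k \<and> norm (\<Gamma> (F (X k))) \<le> h (scalar_seq k)"
proof (induction k)
  case (Suc k)
  note step = scalar_seq_bounds[of k] conjunct1[OF Suc] conjunct2[OF Suc]
  have "norm (X (Suc k) - x0) \<le> norm (X k - x0) + norm (halley_incr (X k))"
    unfolding halley_seq_Suc using norm_triangle_ineq[of "X k - x0" "halley_incr (X k)"] by (simp add: algebra_simps)
  then show ?case
    using norm_halley_incr_le[OF step] F_halley_step_le[OF step] Suc
    unfolding halley_seq_Suc by simp
qed (use F_x0 in simp)

text \<open>Ordered to discharge, one after the other, the premises \<open>t\<close>,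
  \<open>x\<close> and \<open>Fx\<close> of the single-step lemmas.\<close>

lemmas halley_seq_step =
  scalar_seq_bounds conjunct1[OF halley_seq_invariant] conjunct2[OF halley_seq_invariant]

lemma halley_seq_in_ball: "X k \<in> ball x0 ts"
  using halley_seq_invariant[of k] scalar_seq_bounds[of k]
  by (simp add: dist_norm norm_minus_commute)

text \<open>Telescoping the step bounds; the Cauchy property of \<open>scalar_seq\<close> thereby
  passes to \<open>X\<close>.\<close>

lemma halley_seq_dist_le: "m \<le> n \<Longrightarrow> norm (X n - X m) \<le> scalar_seq n - scalar_seq m"
proof (induction n rule: dec_induct)
  case (step n)
  have "norm (X (Suc n) - X m) \<le> norm (halley_incr (X n)) + norm (X n - X m)"
    unfolding halley_seq_Suc using norm_triangle_ineq[of "halley_incr (X n)" "X n - X m"]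
    by (simp add: algebra_simps)
  then show ?case
    using norm_halley_incr_le[OF halley_seq_step, of n] step by simp
qed simp

lemma convergent_halley_seq: "convergent X"
  unfolding Cauchy_convergent_iff[symmetric]
proof (rule metric_CauchyI)
  fix e :: real assume "e > 0"
  then obtain M where M: "\<And>m n. m \<ge> M \<Longrightarrow> n \<ge> M \<Longrightarrow> dist (scalar_seq m) (scalar_seq n) < e"
    using convergent_Cauchy[OF convergent_scalar_seq] unfolding Cauchy_def by blast
  have le: "dist (X m) (X n) \<le> dist (scalar_seq m) (scalar_seq n)" for m n
    using halley_seq_dist_le[of m n] halley_seq_dist_le[of n m]
    by (cases "m \<le> n") (auto simp: dist_norm norm_minus_commute)
  show "\<exists>M. \<forall>m\<ge>M. \<forall>n\<ge>M. dist (X m) (X n) < e"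
    using M le order.strict_trans1 by blast
qed

text \<open>As \<open>ts < R\<close>, the closed ball still lies in \<open>ball x0 R\<close>, where
  \<open>F\<close> is continuous. The residuals after applying \<open>\<Gamma>\<close> tend to zero,
  and \<open>\<Gamma>\<close> is injective.\<close>

lemma halley_seq_limit:
  assumes "X \<longlonglongrightarrow> xs"
  shows "xs \<in> closure (ball x0 ts)" "xs \<in> ball x0 R" "F xs = 0"
proof -
  show cl: "xs \<in> closure (ball x0 ts)"
    using assms halley_seq_in_ball by (meson closure_sequential)
  then show ball: "xs \<in> ball x0 R" using ts by auto
  have "isCont F xs" using deriv_F[OF ball] has_derivative_continuous by blast
  then have "(\<lambda>k. \<Gamma> (F (X k))) \<longlonglongrightarrow> \<Gamma> (F xs)"
    using isCont_tendsto_compose[OF _ assms] by (intro blinfun.tendsto tendsto_const) auto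
  moreover have "(\<lambda>k. \<Gamma> (F (X k))) \<longlonglongrightarrow> 0"
    by (rule Lim_null_comparison[OF _ h_scalar_seq_tendsto]) (use halley_seq_invariant in auto)
  ultimately have "\<Gamma> (F xs) = 0" by (rule LIMSEQ_unique)
  then show "F xs = 0" by (metis \<Gamma>_inverse(2) blinfun.zero_right)
qed

end

theorem theorem2:
  fixes F :: "'a::banach \<Rightarrow> 'b::banach"
    and F' :: "'a \<Rightarrow> 'a \<Rightarrow>\<^sub>L 'b"
    and F'' :: "'a \<Rightarrow> 'a \<Rightarrow>\<^sub>L 'a \<Rightarrow>\<^sub>L 'b"
    and D :: "'a set"
    and x0 :: 'a
    and R tstar :: real
    and h h' h'' :: "real \<Rightarrow> real"
  assumes "D \<noteq> {}" and "open D" and "convex D"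
    and "twice_cont_frechet_diff_on D F F' F''"
    and "x0 \<in> D" and "boundedly_invertible (F' x0)"
    and "R > 0" and "majorizing_function D F F' F'' x0 R h h' h''"
    and "is_smallest_zero h R tstar"
  shows "(\<forall>k. halley_step_defined D F F' F'' (halley_seq F F' F'' x0 k)) \<and>
    (\<forall>k. halley_seq F F' F'' x0 k \<in> ball x0 tstar) \<and>
    (\<exists>xstar \<in> closure (ball x0 tstar).
       halley_seq F F' F'' x0 \<longlonglongrightarrow> xstar \<and> xstar \<in> D \<and> F xstar = 0)"
proof -
  have diff: "\<forall>x\<in>D. (F has_derivative F' x) (at x) \<and> (F' has_derivative F'' x) (at x)"
    using assms(4) unfolding twice_cont_frechet_diff_on_def by blast
  have sub: "ball x0 R \<subseteq> D" using assms(8) unfolding majorizing_function_def by blast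
  have "\<exists>t. is_smallest_zero h R t \<and> h' t < 0"
    using assms(8) unfolding majorizing_function_def by blast
  \<comment> \<open>The smallest zero is unique, so the one supplied by the majorant condition is
    \<open>tstar\<close>.\<close>
  then have h'_tstar: "h' tstar < 0"
    using assms(9) unfolding is_smallest_zero_def by (metis order_antisym)
  interpret majorized_operator h h' h'' R tstar F F' F'' x0
    using assms(6,8,9) h'_tstar sub diff unfolding majorizing_function_def
    by unfold_locales blast+
  have "halley_step_defined D F F' F'' (X k)" for k
    unfolding halley_step_defined_def
    using boundedly_invertible_F'[OF halley_seq_step, of k]
      boundedly_invertible_id_minus_halley_L[OF halley_seq_step, of k]
      halley_seq_in_ball[of k] ts(2) sub subset_ball[of tstar R x0] by auto
  moreover obtain xs where "X \<longlonglongrightarrow> xs"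
    using convergent_halley_seq by (auto simp: convergent_def)
  ultimately show ?thesis
    using halley_seq_in_ball halley_seq_limit[of xs] sub by blast
qed

end
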